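(* Let $f:\mathbb{R}^n\to\mathbb{R}$ be continuously differentiable, and let $\Theta$ be an open neighborhood of the level set $\{x\in\mathbb{R}^n:f(x)\le f(x_0)\}$. Suppose that $f$ is bounded from below on $\Theta$ and that its gradient $g=\nabla f$ is Lipschitz continuous on $\Theta$, i.e. there is $L>0$ with $\|g(x)-g(y)\|\le L\|x-y\|$ for all $x,y\in\Theta$. If the iterative sequence $\{x_k\}$ is generated by the method SMCG_PR (i.e. by SMCG_PR1 or by SMCG_PR2) described in the context, started at $x_0$, with $g_k\ne0$ for every $k$, then $$\lim_{k\to\infty}\|g(x_k)\|=0 .$$
   Context: Notation: $f_k=f(x_k)$, $g_k=\nabla f(x_k)$, $s_{k-1}=x_k-x_{k-1}$, $y_{k-1}=g_k-g_{k-1}$, $\|\cdot\|$ is the Euclidean norm. SMCG_PR. Fixed parameters: $p>2$ (explicit root formulas are used for $p=3,4$), $0<\delta<\sigma<1$, positive constants $\xi_1,\xi_2,\xi_4,\xi_5$, $\xi_3\in(0,1)$, small positive thresholds $\tau_1,\tau_2$, $\gamma\in(0,1)$, positive integers MaxRestart, MinQuad. Start: $x_0\in\mathbb{R}^n$, $d_0=-g_0$. Iteration: $x_{k+1}=x_k+\alpha_kd_k$, where $\alpha_k>0$ satisfies the nonmonotone Wolfe conditions $f(x_k+\alpha_kd_k)\le C_k+\delta\alpha_kg_k^Td_k$ and $\nabla f(x_k+\alpha_kd_k)^Td_k\ge\sigma g_k^Td_k$. Here $C_0=f_0$, $Q_0=1$, $C_1=\min\{C_0,f_1+1\}$, $Q_1=2$,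 and for $k\ge1$: $Q_{k+1}=\eta_kQ_k+1$, $C_{k+1}=(\eta_kQ_kC_k+f_{k+1})/Q_{k+1}$, where, with $l=\max(20,n)$, $\eta_k=1$ if $l\nmid k$, while if $l\mid k$ then $\eta_k=0.7$ when $C_k-f_{k+1}>0.999|C_k|$ and $\eta_k=0.999$ otherwise. Consequently $s_{k-1}^Ty_{k-1}>0$ for $k\ge1$. Direction $d_k$, $k\ge1$ (a test containing an undefined quantity is regarded as failing). Tests: - (Q) at least one of the following holds: (i) $t_k\le\tau_1$, or ($t_k\le\tau_2$ and $t_{k-1}\le\tau_2$), where $t_k=\left|\frac{2(f_{k-1}-f_k+g_k^Ts_{k-1})}{s_{k-1}^Ty_{k-1}}-1\right|$; (ii) $|\theta_k-1|<\gamma$, where $\theta_k=\frac{f_{k-1}-f_k}{0.5\,s_{k-1}^Ty_{k-1}-g_k^Ts_{k-1}}$; (iii) $(s_{k-1}^Ty_{k-1})^2\le10^{-5}\|s_{k-1}\|^2\|y_{k-1}\|^2$ and $\left(f_k-f_{k-1}-0.5(g_{k-1}^Ts_{k-1}+g_k^Ts_{k-1})\right)^2\le10^{-6}\|s_{k-1}\|^2\|y_{k-1}\|^2$. - (W) $\xi_1\le\frac{s_{k-1}^Ty_{k-1}}{\|s_{k-1}\|^2}\le\frac{\|y_{k-1}\|^2}{s_{k-1}^Ty_{k-1}}\le\xi_2$. - (S) $\frac{|g_k^Ty_{k-1}\,g_k^Ts_{k-1}|}{s_{k-1}^Ty_{k-1}\|g_k\|^2}\le\xi_3$ and $\xi_1\le\frac{s_{k-1}^Ty_{k-1}}{\|s_{k-1}\|^2}$.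 Quantities: $\rho_k=\frac32\frac{\|y_{k-1}\|^2}{s_{k-1}^Ty_{k-1}}\|g_k\|^2$, $B_k=\begin{pmatrix}\rho_k & g_k^Ty_{k-1} \\ g_k^Ty_{k-1} & s_{k-1}^Ty_{k-1}\end{pmatrix}$, $\Delta_k=\det B_k$, $b_k=(\|g_k\|^2,\,g_k^Ts_{k-1})^T$, $E_k=\begin{pmatrix}\|g_k\|^2 & g_k^Ts_{k-1} \\ g_k^Ts_{k-1} & \|s_{k-1}\|^2\end{pmatrix}$, $\bar\mu_k=\frac{1}{\Delta_k}(g_k^Ty_{k-1}g_k^Ts_{k-1}-s_{k-1}^Ty_{k-1}\|g_k\|^2)$, $\bar\nu_k=\frac1{\Delta_k}(g_k^Ty_{k-1}\|g_k\|^2-\rho_kg_k^Ts_{k-1})$. Restart counters IterRestart, IterQuad, Isnotgra start at $0$. Once $x_k$ ($k\ge1$) is computed, IterRestart is increased by 1; with $r_{k-1}=\left|\frac{f_k}{f_{k-1}+0.5(g_{k-1}^Ts_{k-1}+g_k^Ts_{k-1})}-1\right|$ and $\bar r_{k-1}=|f_k-f_{k-1}-0.5(g_{k-1}^Ts_{k-1}+g_k^Ts_{k-1})|$, IterQuad is increased by 1 if $r_{k-1}\le\xi_4$ or $\bar r_{k-1}\le\xi_5$, and reset to $0$ otherwise. Then: 1. If Isnotgra $=$ MaxRestart, or (IterQuad $=$ MinQuad and IterRestart $\ne$ IterQuad): $d_k=-g_k$; reset Isnotgra and IterRestart to $0$. 2. Otherwise, if (W) and (Q) hold: $d_k=\bar\mu_kg_k+\bar\nu_ks_{k-1}$;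 increase Isnotgra by 1. 3. Otherwise, if (W) holds and (Q) fails: $d_k$ is the regularized direction below; increase Isnotgra by 1. 4. Otherwise ((W) fails), if (S) holds: $d_k=-g_k+\frac{g_k^Ty_{k-1}}{d_{k-1}^Ty_{k-1}}d_{k-1}$ (Hestenes–Stiefel direction); increase Isnotgra by 1. 5. Otherwise: $d_k=-g_k$; reset Isnotgra and IterRestart to $0$. Regularized direction in SMCG_PR1: $\sigma_k=p\,|f_{k-1}-f_k+g_k^Ts_{k-1}-\frac12s_{k-1}^Ty_{k-1}|/(s_{k-1}^Ty_{k-1})^{p/2}$, $z^*$ is the unique positive solution of $\sigma_kz^{p-1}+z-\sqrt{b_k^TB_k^{-1}b_k}=0$, and $d_k=\frac{1}{1+\min\{\sigma_k(z^* )^{p-2},1\}}(\bar\mu_kg_k+\bar\nu_ks_{k-1})$. Regularized direction in SMCG_PR2: $d_k=\hat\mu_kg_k+\hat\nu_ks_{k-1}$ with $\hat\mu_k=\frac1{\bar\Delta_k}\left(g_k^Ty_{k-1}g_k^Ts_{k-1}-s_{k-1}^Ty_{k-1}\|g_k\|^2+\lambda(g_k^Ts_{k-1})^2-\lambda\|s_{k-1}\|^2\|g_k\|^2\right)$, $\hat\nu_k=\frac1{\bar\Delta_k}\left(g_k^Ty_{k-1}\|g_k\|^2-\rho_kg_k^Ts_{k-1}\right)$, $\bar\Delta_k=(\rho_k+\lambda\|g_k\|^2)(s_{k-1}^Ty_{k-1}+\lambda\|s_{k-1}\|^2)-(g_k^Ty_{k-1}+\lambda g_k^Ts_{k-1})^2$.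 If $(g_k^Ts_{k-1})^2>(1-10^{-5})\|g_k\|^2\|s_{k-1}\|^2$ then $\lambda=0$; otherwise $\lambda=\min\left\{\sigma_k(z^* )^{p-2},\frac{\|y_{k-1}\|^2}{s_{k-1}^Ty_{k-1}}\right\}$, where $\sigma_k=p\,|f_{k-1}-f_k+g_k^Ts_{k-1}-\frac12s_{k-1}^Ty_{k-1}|/\|s_{k-1}\|^{p/2}$ and $z^*$ is the unique non-negative solution of $z^2=\sum_{i=1}^2\frac{\beta_i^2}{(\mu_i+\sigma_kz^{p-2})^2}$, with $0<\mu_1\le\mu_2$ the eigenvalues of $E_k^{-1/2}B_kE_k^{-1/2}$, $V$ orthogonal with $V^TE_k^{-1/2}B_kE_k^{-1/2}V=\mathrm{diag}(\mu_1,\mu_2)$ and $\beta=V^TE_k^{-1/2}b_k$. *)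

theory Defs
  imports "HOL-Analysis.Analysis"
begin

text \<open>The inverse square root \<open>M\<^sup>-\<^sup>1\<^sup>/\<^sup>2\<close> of a symmetric positive definite matrix, i.e. the unique
  symmetric positive definite square root of its inverse.\<close>

definition mat_inv_sqrt :: "real^'m^'m \<Rightarrow> real^'m^'m" where
  "mat_inv_sqrt M =
     (THE R. transpose R = R \<and> (\<forall>v. v \<noteq> 0 \<longrightarrow> 0 < v \<bullet> (R *v v)) \<and> R ** R = matrix_inv M)"

text \<open>In the following \<open>f\<close> is the objective, \<open>g\<close> its gradient and \<open>x\<close> the sequence of iterates.
  All quantities that refer to the step from \<open>x (k - 1)\<close> to \<open>x k\<close> carry the index \<open>k\<close> and are used
  for \<open>k \<ge> 1\<close> only; just \<open>svec\<close> and \<open>yvec\<close> are indexed by the start of the step.\<close>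

context
  fixes f :: "real^'n \<Rightarrow> real"
    and g :: "real^'n \<Rightarrow> real^'n"
    and x :: "nat \<Rightarrow> real^'n"
begin

abbreviation (input) fv :: "nat \<Rightarrow> real" where "fv k \<equiv> f (x k)"

abbreviation (input) gv :: "nat \<Rightarrow> real^'n" where "gv k \<equiv> g (x k)"

definition svec :: "nat \<Rightarrow> real^'n" where "svec k = x (Suc k) - x k"

definition yvec :: "nat \<Rightarrow> real^'n" where "yvec k = gv (Suc k) - gv k"

definition sty :: "nat \<Rightarrow> real" where "sty k = svec (k - 1) \<bullet> yvec (k - 1)"

definition gts :: "nat \<Rightarrow> real" where "gts k = gv k \<bullet> svec (k - 1)"

definition gty :: "nat \<Rightarrow> real" where "gty k = gv k \<bullet> yvec (k - 1)"

subsection \<open>Nonmonotone line search\<close>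

definition eta :: "nat \<Rightarrow> real \<Rightarrow> real \<Rightarrow> real" where
  "eta k C fnew =
     (if max 20 CARD('n) dvd k
      then (if C - fnew > 0.999 * \<bar>C\<bar> then 0.7 else 0.999)
      else 1)"

fun nmQ :: "nat \<Rightarrow> real" and nmC :: "nat \<Rightarrow> real" where
  "nmQ 0 = 1"
| "nmQ (Suc 0) = 2"
| "nmQ (Suc (Suc j)) =
     (let k = Suc j in eta k (nmC k) (fv (Suc k)) * nmQ k + 1)"
| "nmC 0 = fv 0"
| "nmC (Suc 0) = min (fv 0) (fv 1 + 1)"
| "nmC (Suc (Suc j)) =
     (let k = Suc j; \<eta> = eta k (nmC k) (fv (Suc k)) in
       (\<eta> * nmQ k * nmC k + fv (Suc k)) / (\<eta> * nmQ k + 1))"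

subsection \<open>Tests\<close>

definition tval :: "nat \<Rightarrow> real" where
  "tval k = \<bar>2 * (fv (k - 1) - fv k + gts k) / sty k - 1\<bar>"

text \<open>A comparison involving an undefined quantity counts as false: \<open>tval 0\<close> does not exist,
  and the denominators of \<open>\<theta>\<close> and of \<open>r\<close> below may vanish.\<close>

definition test_Q :: "real \<Rightarrow> real \<Rightarrow> real \<Rightarrow> nat \<Rightarrow> bool" where
  "test_Q \<tau>\<^sub>1 \<tau>\<^sub>2 \<gamma> k \<longleftrightarrow>
     (tval k \<le> \<tau>\<^sub>1 \<or> (tval k \<le> \<tau>\<^sub>2 \<and> k \<ge> 2 \<and> tval (k - 1) \<le> \<tau>\<^sub>2))
   \<or> (0.5 * sty k - gts k \<noteq> 0 \<and>
        \<bar>(fv (k - 1) - fv k) / (0.5 * sty k - gts k) - 1\<bar> < \<gamma>)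
   \<or> ((sty k)\<^sup>2 \<le> 1 / 10 ^ 5 * (norm (svec (k - 1)))\<^sup>2 * (norm (yvec (k - 1)))\<^sup>2 \<and>
      (fv k - fv (k - 1) - 0.5 * (gv (k - 1) \<bullet> svec (k - 1) + gts k))\<^sup>2
        \<le> 1 / 10 ^ 6 * (norm (svec (k - 1)))\<^sup>2 * (norm (yvec (k - 1)))\<^sup>2)"

definition test_W :: "real \<Rightarrow> real \<Rightarrow> nat \<Rightarrow> bool" where
  "test_W \<xi>\<^sub>1 \<xi>\<^sub>2 k \<longleftrightarrow>
     \<xi>\<^sub>1 \<le> sty k / (norm (svec (k - 1)))\<^sup>2 \<and>
     sty k / (norm (svec (k - 1)))\<^sup>2 \<le> (norm (yvec (k - 1)))\<^sup>2 / sty k \<and>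
     (norm (yvec (k - 1)))\<^sup>2 / sty k \<le> \<xi>\<^sub>2"

definition test_S :: "real \<Rightarrow> real \<Rightarrow> nat \<Rightarrow> bool" where
  "test_S \<xi>\<^sub>1 \<xi>\<^sub>3 k \<longleftrightarrow>
     \<bar>gty k * gts k\<bar> / (sty k * (norm (gv k))\<^sup>2) \<le> \<xi>\<^sub>3 \<and>
     \<xi>\<^sub>1 \<le> sty k / (norm (svec (k - 1)))\<^sup>2"

text \<open>The condition under which the counter IterQuad is increased; the two disjuncts are
  \<open>r \<le> \<xi>\<^sub>4\<close> and \<open>rbar \<le> \<xi>\<^sub>5\<close> for the step from \<open>x (k - 1)\<close> to \<open>x k\<close>.\<close>

definition quad_test :: "real \<Rightarrow> real \<Rightarrow> nat \<Rightarrow> bool" where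
  "quad_test \<xi>\<^sub>4 \<xi>\<^sub>5 k \<longleftrightarrow>
     (let h = 0.5 * (gv (k - 1) \<bullet> svec (k - 1) + gts k) in
       (fv (k - 1) + h \<noteq> 0 \<and> \<bar>fv k / (fv (k - 1) + h) - 1\<bar> \<le> \<xi>\<^sub>4) \<or>
       \<bar>fv k - fv (k - 1) - h\<bar> \<le> \<xi>\<^sub>5)"

subsection \<open>Search directions\<close>

definition rho :: "nat \<Rightarrow> real" where
  "rho k = 3 / 2 * ((norm (yvec (k - 1)))\<^sup>2 / sty k) * (norm (gv k))\<^sup>2"

definition Bmat :: "nat \<Rightarrow> real^2^2" where
  "Bmat k = vector [vector [rho k, gty k], vector [gty k, sty k]]"

definition Emat :: "nat \<Rightarrow> real^2^2" where
  "Emat k = vector [vector [(norm (gv k))\<^sup>2, gts k], vector [gts k, (norm (svec (k - 1)))\<^sup>2]]"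

definition bvec :: "nat \<Rightarrow> real^2" where
  "bvec k = vector [(norm (gv k))\<^sup>2, gts k]"

definition mu_bar :: "nat \<Rightarrow> real" where
  "mu_bar k = 1 / det (Bmat k) * (gty k * gts k - sty k * (norm (gv k))\<^sup>2)"

definition nu_bar :: "nat \<Rightarrow> real" where
  "nu_bar k = 1 / det (Bmat k) * (gty k * (norm (gv k))\<^sup>2 - rho k * gts k)"

definition quad_dir :: "nat \<Rightarrow> real^'n" where
  "quad_dir k = mu_bar k *\<^sub>R gv k + nu_bar k *\<^sub>R svec (k - 1)"

text \<open>The regularized direction of SMCG\_PR1, for the exponent \<open>p\<close>.\<close>

definition sigma1 :: "real \<Rightarrow> nat \<Rightarrow> real" where
  "sigma1 p k = p * \<bar>fv (k - 1) - fv k + gts k - 1 / 2 * sty k\<bar> / sty k powr (p / 2)"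

definition zstar1 :: "real \<Rightarrow> nat \<Rightarrow> real" where
  "zstar1 p k = (THE z. z > 0 \<and>
     sigma1 p k * z powr (p - 1) + z - sqrt (bvec k \<bullet> (matrix_inv (Bmat k) *v bvec k)) = 0)"

definition reg_dir1 :: "real \<Rightarrow> nat \<Rightarrow> real^'n" where
  "reg_dir1 p k =
     (1 / (1 + min (sigma1 p k * zstar1 p k powr (p - 2)) 1)) *\<^sub>R
       (mu_bar k *\<^sub>R gv k + nu_bar k *\<^sub>R svec (k - 1))"

text \<open>The regularized direction of SMCG\_PR2. The diagonalisation below (of \<open>E\<^sup>-\<^sup>1\<^sup>/\<^sup>2 B E\<^sup>-\<^sup>1\<^sup>/\<^sup>2\<close>) makes
  \<open>\<mu>\<^sub>1 \<le> \<mu>\<^sub>2\<close> its eigenvalues; \<open>V\<close> is not unique, but the equation for \<open>z\<close> does not depend on the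
  choice of \<open>V\<close>.\<close>

definition sigma2 :: "real \<Rightarrow> nat \<Rightarrow> real" where
  "sigma2 p k =
     p * \<bar>fv (k - 1) - fv k + gts k - 1 / 2 * sty k\<bar> / norm (svec (k - 1)) powr (p / 2)"

definition zstar2 :: "real \<Rightarrow> nat \<Rightarrow> real" where
  "zstar2 p k = (THE z. z \<ge> 0 \<and>
     (\<exists>(V :: real^2^2) \<mu>\<^sub>1 \<mu>\<^sub>2 (\<beta> :: real^2).
        0 < \<mu>\<^sub>1 \<and> \<mu>\<^sub>1 \<le> \<mu>\<^sub>2 \<and> orthogonal_matrix V \<and>
        transpose V ** (mat_inv_sqrt (Emat k) ** Bmat k ** mat_inv_sqrt (Emat k)) ** V
          = vector [vector [\<mu>\<^sub>1, 0], vector [0, \<mu>\<^sub>2]] \<and>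
        \<beta> = transpose V *v (mat_inv_sqrt (Emat k) *v bvec k) \<and>
        z\<^sup>2 = (\<beta> $ 1)\<^sup>2 / (\<mu>\<^sub>1 + sigma2 p k * z powr (p - 2))\<^sup>2
            + (\<beta> $ 2)\<^sup>2 / (\<mu>\<^sub>2 + sigma2 p k * z powr (p - 2))\<^sup>2))"

definition lambda2 :: "real \<Rightarrow> nat \<Rightarrow> real" where
  "lambda2 p k =
     (if (gts k)\<^sup>2 > (1 - 1 / 10 ^ 5) * (norm (gv k))\<^sup>2 * (norm (svec (k - 1)))\<^sup>2 then 0
      else min (sigma2 p k * zstar2 p k powr (p - 2)) ((norm (yvec (k - 1)))\<^sup>2 / sty k))"

definition Delta_bar :: "real \<Rightarrow> nat \<Rightarrow> real" where
  "Delta_bar p k =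
     (rho k + lambda2 p k * (norm (gv k))\<^sup>2) * (sty k + lambda2 p k * (norm (svec (k - 1)))\<^sup>2)
       - (gty k + lambda2 p k * gts k)\<^sup>2"

definition mu_hat :: "real \<Rightarrow> nat \<Rightarrow> real" where
  "mu_hat p k =
     1 / Delta_bar p k *
       (gty k * gts k - sty k * (norm (gv k))\<^sup>2
        + lambda2 p k * (gts k)\<^sup>2 - lambda2 p k * (norm (svec (k - 1)))\<^sup>2 * (norm (gv k))\<^sup>2)"

definition nu_hat :: "real \<Rightarrow> nat \<Rightarrow> real" where
  "nu_hat p k = 1 / Delta_bar p k * (gty k * (norm (gv k))\<^sup>2 - rho k * gts k)"

definition reg_dir2 :: "real \<Rightarrow> nat \<Rightarrow> real^'n" where
  "reg_dir2 p k = mu_hat p k *\<^sub>R gv k + nu_hat p k *\<^sub>R svec (k - 1)"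

subsection \<open>The method\<close>

text \<open>\<open>\<alpha>\<close> and \<open>d\<close> are the step lengths and directions of a run, and \<open>reg k\<close> is the regularized
  direction. The value of a counter at index \<open>k\<close> is its value after \<open>d k\<close> has been computed.\<close>

definition SMCG_PR ::
  "(nat \<Rightarrow> real^'n) \<Rightarrow> real \<Rightarrow> real \<Rightarrow> real \<Rightarrow> real \<Rightarrow> real \<Rightarrow> real \<Rightarrow> real \<Rightarrow>
   real \<Rightarrow> real \<Rightarrow> real \<Rightarrow> nat \<Rightarrow> nat \<Rightarrow> (nat \<Rightarrow> real) \<Rightarrow> (nat \<Rightarrow> real^'n) \<Rightarrow> bool" where
  "SMCG_PR reg \<delta> \<sigma> \<xi>\<^sub>1 \<xi>\<^sub>2 \<xi>\<^sub>3 \<xi>\<^sub>4 \<xi>\<^sub>5 \<tau>\<^sub>1 \<tau>\<^sub>2 \<gamma> MaxRestart MinQuad \<alpha> d \<longleftrightarrow>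
     d 0 = - gv 0 \<and>
     (\<forall>k. 0 < \<alpha> k \<and> x (Suc k) = x k + \<alpha> k *\<^sub>R d k \<and>
          f (x k + \<alpha> k *\<^sub>R d k) \<le> nmC k + \<delta> * \<alpha> k * (gv k \<bullet> d k) \<and>
          g (x k + \<alpha> k *\<^sub>R d k) \<bullet> d k \<ge> \<sigma> * (gv k \<bullet> d k)) \<and>
     (\<exists>IterRestart IterQuad Isnotgra :: nat \<Rightarrow> nat.
        IterRestart 0 = 0 \<and> IterQuad 0 = 0 \<and> Isnotgra 0 = 0 \<and>
        (\<forall>k\<ge>1.
          let ir = IterRestart (k - 1) + 1;
              iq = (if quad_test \<xi>\<^sub>4 \<xi>\<^sub>5 k then IterQuad (k - 1) + 1 else 0);
              ig = Isnotgra (k - 1)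
          in IterQuad k = iq \<and>
             (if ig = MaxRestart \<or> (iq = MinQuad \<and> ir \<noteq> iq)
              then d k = - gv k \<and> Isnotgra k = 0 \<and> IterRestart k = 0
              else if test_W \<xi>\<^sub>1 \<xi>\<^sub>2 k \<and> test_Q \<tau>\<^sub>1 \<tau>\<^sub>2 \<gamma> k
              then d k = quad_dir k \<and> Isnotgra k = ig + 1 \<and> IterRestart k = ir
              else if test_W \<xi>\<^sub>1 \<xi>\<^sub>2 k
              then d k = reg k \<and> Isnotgra k = ig + 1 \<and> IterRestart k = ir
              else if test_S \<xi>\<^sub>1 \<xi>\<^sub>3 k
              then d k = - gv k + (gty k / (d (k - 1) \<bullet> yvec (k - 1))) *\<^sub>R d (k - 1) \<and>
                   Isnotgra k = ig + 1 \<and> IterRestart k = ir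
              else d k = - gv k \<and> Isnotgra k = 0 \<and> IterRestart k = 0)))"

definition SMCG_PR1 ::
  "real \<Rightarrow> real \<Rightarrow> real \<Rightarrow> real \<Rightarrow> real \<Rightarrow> real \<Rightarrow> real \<Rightarrow> real \<Rightarrow> real \<Rightarrow>
   real \<Rightarrow> real \<Rightarrow> nat \<Rightarrow> nat \<Rightarrow> (nat \<Rightarrow> real) \<Rightarrow> (nat \<Rightarrow> real^'n) \<Rightarrow> bool" where
  "SMCG_PR1 p = SMCG_PR (reg_dir1 p)"

definition SMCG_PR2 ::
  "real \<Rightarrow> real \<Rightarrow> real \<Rightarrow> real \<Rightarrow> real \<Rightarrow> real \<Rightarrow> real \<Rightarrow> real \<Rightarrow> real \<Rightarrow>
   real \<Rightarrow> real \<Rightarrow> nat \<Rightarrow> nat \<Rightarrow> (nat \<Rightarrow> real) \<Rightarrow> (nat \<Rightarrow> real^'n) \<Rightarrow> bool" where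
  "SMCG_PR2 p = SMCG_PR (reg_dir2 p)"

end

end

theory Submission
  imports Defs
begin

text \<open>Every search direction satisfies \<open>g\<^sub>k \<bullet> d\<^sub>k \<le> - c \<parallel>g\<^sub>k\<parallel>\<^sup>2\<close> and \<open>\<parallel>d\<^sub>k\<parallel> \<le> M \<parallel>g\<^sub>k\<parallel>\<close> with constants
  independent of \<open>k\<close>. For the regularized directions neither the value of \<open>z\<^sup>*\<close> nor its existence
  matters: SMCG\_PR1 only shrinks the quadratic direction by a factor in \<open>[1/2, 1]\<close>, and in SMCG\_PR2
  the bounds hold uniformly for all regularization parameters in \<open>[0, \<xi>\<^sub>2]\<close>. The Wolfe curvature
  condition and the Lipschitz bound then give \<open>\<alpha>\<^sub>k \<bar>g\<^sub>k \<bullet> d\<^sub>k\<bar> \<ge> K \<parallel>g\<^sub>k\<parallel>\<^sup>2\<close> with \<open>K > 0\<close>. Since \<open>Q\<^sub>k\<close> stays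
  bounded, \<open>C\<^sub>k - C\<^sub>k\<^sub>+\<^sub>1 = (C\<^sub>k - f\<^sub>k\<^sub>+\<^sub>1) / Q\<^sub>k\<^sub>+\<^sub>1\<close> dominates a multiple of \<open>\<parallel>g\<^sub>k\<parallel>\<^sup>2\<close>; it tends to \<open>0\<close>
  because \<open>C\<^sub>k\<close> decreases and is bounded below.\<close>

section \<open>Uniform descent for the regularized two-dimensional model\<close>

definition sufficient_descent :: "real \<Rightarrow> real \<Rightarrow> 'a::real_inner \<Rightarrow> 'a \<Rightarrow> bool" where
  "sufficient_descent c M v d \<longleftrightarrow> v \<bullet> d \<le> - c * (norm v)\<^sup>2 \<and> norm d \<le> M * norm v"

text \<open>The vector \<open>(\<mu>, \<nu>)\<close> is \<open>- (B + \<kappa> E)\<^sup>-\<^sup>1 b\<close> for the matrices of the method, and \<open>\<Delta>\<close> is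
  \<open>det (B + \<kappa> E)\<close>; \<open>\<kappa> = 0\<close> is the quadratic direction.\<close>

lemma regularized_model_minimizer:
  fixes v s y :: "'a::real_inner" and \<kappa> \<xi>\<^sub>1 \<xi>\<^sub>2 :: real
  assumes sy: "0 < s \<bullet> y" and v: "v \<noteq> 0" and pos: "0 < \<xi>\<^sub>1" "0 < \<xi>\<^sub>2"
    and lo: "\<xi>\<^sub>1 * (norm s)\<^sup>2 \<le> s \<bullet> y" and up: "(norm y)\<^sup>2 \<le> \<xi>\<^sub>2 * (s \<bullet> y)"
    and lam: "0 \<le> \<kappa>" "\<kappa> \<le> \<xi>\<^sub>2"
  defines "\<rho> \<equiv> 3 / 2 * ((norm y)\<^sup>2 / (s \<bullet> y)) * (norm v)\<^sup>2"
  defines "\<Delta> \<equiv> (\<rho> + \<kappa> * (norm v)\<^sup>2) * (s \<bullet> y + \<kappa> * (norm s)\<^sup>2) - (v \<bullet> y + \<kappa> * (v \<bullet> s))\<^sup>2"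
  defines "\<mu> \<equiv> 1 / \<Delta> * ((v \<bullet> y) * (v \<bullet> s) - (s \<bullet> y) * (norm v)\<^sup>2
                 + \<kappa> * (v \<bullet> s)\<^sup>2 - \<kappa> * (norm s)\<^sup>2 * (norm v)\<^sup>2)"
  defines "\<nu> \<equiv> 1 / \<Delta> * ((v \<bullet> y) * (norm v)\<^sup>2 - \<rho> * (v \<bullet> s))"
  shows "sufficient_descent (2 / (5 * \<xi>\<^sub>2)) (9 / \<xi>\<^sub>1 + 2 * \<xi>\<^sub>2 / \<xi>\<^sub>1\<^sup>2) v (\<mu> *\<^sub>R v + \<nu> *\<^sub>R s)"
proof -
  define G S Y where "G = norm v" and "S = norm s" and "Y = norm y"
  define q where "q = Y\<^sup>2 / (s \<bullet> y)"
  have "s \<noteq> 0" "y \<noteq> 0" using sy by auto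
  then have GSY: "0 < G" "0 < S" "0 < Y"
    using v by (auto simp: G_def S_def Y_def)
  have vy: "\<bar>v \<bullet> y\<bar> \<le> G * Y" and vs: "\<bar>v \<bullet> s\<bar> \<le> G * S" and sy_le: "s \<bullet> y \<le> S * Y"
    using Cauchy_Schwarz_ineq2[of v y] Cauchy_Schwarz_ineq2[of v s] norm_cauchy_schwarz[of s y]
    by (auto simp: G_def S_def Y_def)
  have q: "0 < q" "q \<le> \<xi>\<^sub>2" "q * (s \<bullet> y) = Y\<^sup>2"
    using sy up GSY by (auto simp: q_def Y_def field_simps)
  have \<rho>: "\<rho> = 3 / 2 * q * G\<^sup>2"
    by (simp add: \<rho>_def q_def G_def Y_def)
  have "\<xi>\<^sub>1 * S * S \<le> Y * S"
    using lo sy_le by (simp add: S_def power2_eq_square algebra_simps)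
  then have SY: "\<xi>\<^sub>1 * S \<le> Y"
    using GSY by (simp add: mult_le_cancel_right)
  \<comment> \<open>The coefficient bounds below reduce to the ratios \<open>S / Y\<close> and
    \<open>S\<^sup>2 / (s \<bullet> y)\<close>, both at most
    \<open>1 / \<xi>\<^sub>1\<close>.\<close>
  then have ratio: "S / Y \<le> 1 / \<xi>\<^sub>1"
    using GSY pos by (simp add: field_simps)
  have vy2: "(v \<bullet> y)\<^sup>2 \<le> G\<^sup>2 * Y\<^sup>2" and vs2: "(v \<bullet> s)\<^sup>2 \<le> G\<^sup>2 * S\<^sup>2"
    using vy vs by (metis abs_le_square_iff abs_of_nonneg GSY less_imp_le mult_nonneg_nonneg power_mult_distrib)+
  have prod_abs: "\<bar>(v \<bullet> y) * (v \<bullet> s)\<bar> \<le> G\<^sup>2 * (Y * S)"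
    using mult_mono[OF vy vs] GSY by (simp add: abs_mult power2_eq_square mult_ac)
  \<comment> \<open>The coefficient of \<open>\<kappa>\<close> in \<open>\<Delta>\<close>, nonnegative by AM-GM.\<close>
  have mixed: "0 \<le> \<rho> * S\<^sup>2 + (s \<bullet> y) * G\<^sup>2 - 2 * (v \<bullet> y) * (v \<bullet> s)"
  proof -
    have "(q * S\<^sup>2 + s \<bullet> y)\<^sup>2 - (2 * (Y * S))\<^sup>2 = (q * S\<^sup>2 - s \<bullet> y)\<^sup>2"
      using q(3) by algebra
    then have "(2 * (Y * S))\<^sup>2 \<le> (q * S\<^sup>2 + s \<bullet> y)\<^sup>2"
      by (metis diff_ge_0_iff_ge zero_le_power2)
    then have "2 * (Y * S) \<le> q * S\<^sup>2 + s \<bullet> y"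
      using q sy by (intro power2_le_imp_le[of "2 * (Y * S)"]) auto
    then have "G\<^sup>2 * (2 * (Y * S)) \<le> G\<^sup>2 * (q * S\<^sup>2 + s \<bullet> y)"
      by (intro mult_left_mono) auto
    moreover have "q * G\<^sup>2 * S\<^sup>2 \<le> \<rho> * S\<^sup>2"
      using q by (simp add: \<rho>)
    ultimately show ?thesis
      using prod_abs by (simp add: algebra_simps)
  qed
  \<comment> \<open>Expansion in \<kappa>: the constant term is the determinant of \<open>B\<close>,
    the leading coefficient that of \<open>E\<close>, the Gram determinant of \<open>v\<close> and
    \<open>s\<close>.\<close>
  have \<Delta>_eq: "\<Delta> = (\<rho> * (s \<bullet> y) - (v \<bullet> y)\<^sup>2)
      + \<kappa> * (\<rho> * S\<^sup>2 + (s \<bullet> y) * G\<^sup>2 - 2 * (v \<bullet> y) * (v \<bullet> s))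
      + \<kappa>\<^sup>2 * (G\<^sup>2 * S\<^sup>2 - (v \<bullet> s)\<^sup>2)"
    by (simp add: \<Delta>_def G_def S_def power2_eq_square algebra_simps)
  \<comment> \<open>The factor \<open>3 / 2\<close> in \<rho> leaves a margin: Cauchy-Schwarz bounds
    \<open>(v \<bullet> y)\<^sup>2\<close> by \<open>Y\<^sup>2 * G\<^sup>2\<close>, so half of this
    product survives in \<Delta>, whatever \<kappa> is.\<close>
  have "\<rho> * (s \<bullet> y) = 3 / 2 * Y\<^sup>2 * G\<^sup>2"
    using q(3) by (simp add: \<rho> algebra_simps)
  moreover have "0 \<le> \<kappa> * (\<rho> * S\<^sup>2 + (s \<bullet> y) * G\<^sup>2 - 2 * (v \<bullet> y) * (v \<bullet> s))"
    using lam mixed by simp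
  moreover have "0 \<le> \<kappa>\<^sup>2 * (G\<^sup>2 * S\<^sup>2 - (v \<bullet> s)\<^sup>2)"
    using vs2 by simp
  ultimately have \<Delta>_ge: "1 / 2 * (Y\<^sup>2 * G\<^sup>2) \<le> \<Delta>"
    using vy2 unfolding \<Delta>_eq by (simp add: algebra_simps)
  have \<Delta>_pos: "0 < \<Delta>"
    using GSY by (intro less_le_trans[OF _ \<Delta>_ge]) simp
  have div_\<Delta>: "a / \<Delta> \<le> 2 * a / (Y\<^sup>2 * G\<^sup>2)" if "0 \<le> a" for a
    using \<Delta>_ge \<Delta>_pos GSY that frac_le[of a a "1 / 2 * (Y\<^sup>2 * G\<^sup>2)" \<Delta>]
    by (simp add: mult.commute)

  define A where "A = \<rho> + \<kappa> * G\<^sup>2"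
  \<comment> \<open>Both \<open>q\<close> and \<kappa> are capped by \<open>\<xi>\<^sub>2\<close>;
    \<open>5 / 2\<close> is \<open>3 / 2 + 1\<close> and produces the descent constant.\<close>
  have A: "0 < A" "A \<le> 5 / 2 * \<xi>\<^sub>2 * G\<^sup>2"
  proof -
    have "0 < \<rho>" using q GSY by (simp add: \<rho>)
    then show "0 < A" using lam by (simp add: A_def add_pos_nonneg)
    have "(3 / 2 * q + \<kappa>) * G\<^sup>2 \<le> (5 / 2 * \<xi>\<^sub>2) * G\<^sup>2"
      using q lam by (intro mult_right_mono) auto
    then show "A \<le> 5 / 2 * \<xi>\<^sub>2 * G\<^sup>2"
      by (simp add: A_def \<rho> algebra_simps)
  qed
  have vd: "v \<bullet> (\<mu> *\<^sub>R v + \<nu> *\<^sub>R s) = \<mu> * G\<^sup>2 + \<nu> * (v \<bullet> s)"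
    by (simp add: inner_add_right power2_norm_eq_inner G_def)
  \<comment> \<open>Completing the square with pivot \<open>A\<close>, the upper left entry of
    \<open>B + \<kappa> E\<close>. It shows that the quadratic form of the inverse at
    \<open>b\<close> is at least the square of the first entry of \<open>b\<close> divided by
    \<open>A\<close>.\<close>
  have "A * \<Delta> * (\<mu> * G\<^sup>2 + \<nu> * (v \<bullet> s)) =
      - (\<Delta> * (G\<^sup>2)\<^sup>2 + (A * (v \<bullet> s) - (v \<bullet> y + \<kappa> * (v \<bullet> s)) * G\<^sup>2)\<^sup>2)"
  proof -
    have "\<Delta> * \<mu> = (v \<bullet> y) * (v \<bullet> s) - (s \<bullet> y) * G\<^sup>2 + \<kappa> * (v \<bullet> s)\<^sup>2 - \<kappa> * S\<^sup>2 * G\<^sup>2"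
      and "\<Delta> * \<nu> = (v \<bullet> y) * G\<^sup>2 - \<rho> * (v \<bullet> s)"
      using \<Delta>_pos by (simp_all add: \<mu>_def \<nu>_def G_def S_def)
    moreover have "\<Delta> = A * (s \<bullet> y + \<kappa> * S\<^sup>2) - (v \<bullet> y + \<kappa> * (v \<bullet> s))\<^sup>2"
      by (simp add: \<Delta>_def A_def G_def S_def)
    moreover note A_def
    ultimately show ?thesis by algebra
  qed
  then have "A * \<Delta> * (\<mu> * G\<^sup>2 + \<nu> * (v \<bullet> s)) \<le> - (\<Delta> * (G\<^sup>2)\<^sup>2)"
    by simp
  then have "\<Delta> * (A * (\<mu> * G\<^sup>2 + \<nu> * (v \<bullet> s)) + (G\<^sup>2)\<^sup>2) \<le> 0"
    by (simp add: algebra_simps)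
  then have "A * (\<mu> * G\<^sup>2 + \<nu> * (v \<bullet> s)) \<le> - (G\<^sup>2)\<^sup>2"
    using \<Delta>_pos by (simp add: mult_le_0_iff)
  then have "\<mu> * G\<^sup>2 + \<nu> * (v \<bullet> s) \<le> - ((G\<^sup>2)\<^sup>2 / A)"
    using A by (simp add: field_simps)
  also have "(G\<^sup>2)\<^sup>2 / (5 / 2 * \<xi>\<^sub>2 * G\<^sup>2) \<le> (G\<^sup>2)\<^sup>2 / A"
    using A by (intro frac_le) auto
  then have "- ((G\<^sup>2)\<^sup>2 / A) \<le> - (2 / (5 * \<xi>\<^sub>2)) * G\<^sup>2"
    using GSY pos by (simp add: field_simps power2_eq_square)
  finally have descent: "v \<bullet> (\<mu> *\<^sub>R v + \<nu> *\<^sub>R s) \<le> - (2 / (5 * \<xi>\<^sub>2)) * G\<^sup>2"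
    unfolding vd .

  have \<mu>_bound: "\<bar>\<mu>\<bar> * G \<le> (4 / \<xi>\<^sub>1 + 2 * \<xi>\<^sub>2 / \<xi>\<^sub>1\<^sup>2) * G"
  proof -
    have "\<bar>(s \<bullet> y) * G\<^sup>2\<bar> \<le> G\<^sup>2 * (Y * S)"
      using sy sy_le GSY by (simp add: abs_mult mult.commute)
    \<comment> \<open>The difference is \<open>- \<kappa>\<close> times the Gram determinant of
      \<open>v\<close> and \<open>s\<close>, which lies between 0 and
      \<open>G\<^sup>2 * S\<^sup>2\<close>.\<close>
    moreover have "\<bar>\<kappa> * (v \<bullet> s)\<^sup>2 - \<kappa> * S\<^sup>2 * G\<^sup>2\<bar> \<le> \<xi>\<^sub>2 * (G\<^sup>2 * S\<^sup>2)"
    proof -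
      have "\<kappa> * (v \<bullet> s)\<^sup>2 \<le> \<kappa> * (G\<^sup>2 * S\<^sup>2)" "0 \<le> \<kappa> * (v \<bullet> s)\<^sup>2"
           "\<kappa> * (G\<^sup>2 * S\<^sup>2) \<le> \<xi>\<^sub>2 * (G\<^sup>2 * S\<^sup>2)"
        using lam vs2 by (auto intro: mult_left_mono mult_right_mono)
      then show ?thesis by (simp add: algebra_simps)
    qed
    ultimately have "\<bar>(v \<bullet> y) * (v \<bullet> s) - (s \<bullet> y) * G\<^sup>2 + \<kappa> * (v \<bullet> s)\<^sup>2 - \<kappa> * S\<^sup>2 * G\<^sup>2\<bar>
        \<le> G\<^sup>2 * (2 * (Y * S) + \<xi>\<^sub>2 * S\<^sup>2)"
      using prod_abs by (simp add: algebra_simps)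
    then have "\<bar>\<mu>\<bar> \<le> G\<^sup>2 * (2 * (Y * S) + \<xi>\<^sub>2 * S\<^sup>2) / \<Delta>"
      using \<Delta>_pos by (simp add: \<mu>_def G_def S_def abs_mult divide_right_mono)
    also have "\<dots> \<le> 2 * (G\<^sup>2 * (2 * (Y * S) + \<xi>\<^sub>2 * S\<^sup>2)) / (Y\<^sup>2 * G\<^sup>2)"
      using GSY pos by (intro div_\<Delta>) auto
    also have "\<dots> = 4 * (S / Y) + 2 * \<xi>\<^sub>2 * (S / Y)\<^sup>2"
      using GSY by (simp add: field_simps power2_eq_square)
    also have "\<dots> \<le> 4 * (1 / \<xi>\<^sub>1) + 2 * \<xi>\<^sub>2 * (1 / \<xi>\<^sub>1)\<^sup>2"
      using ratio GSY pos by (intro add_mono mult_left_mono power_mono) auto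
    finally show ?thesis
      using GSY by (intro mult_right_mono) (auto simp: power_divide)
  qed
  \<comment> \<open>In the second component of \<open>(B + \<kappa> E)\<^sup>-\<^sup>1 b\<close> the
    terms with \<kappa> cancel from the numerator. The 5 is 2 from
    \<open>(v \<bullet> y) * G\<^sup>2\<close> plus 3 from
    \<open>\<rho> * (v \<bullet> s)\<close>.\<close>
  have \<nu>_bound: "\<bar>\<nu>\<bar> * S \<le> 5 / \<xi>\<^sub>1 * G"
  proof -
    have "\<bar>(v \<bullet> y) * G\<^sup>2\<bar> \<le> G * Y * G\<^sup>2"
      using vy by (simp add: abs_mult mult_right_mono)
    moreover have "\<bar>\<rho> * (v \<bullet> s)\<bar> \<le> 3 / 2 * q * G\<^sup>2 * (G * S)"
      using mult_left_mono[OF vs, of "3 / 2 * q * G\<^sup>2"] q by (simp add: \<rho> abs_mult)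
    ultimately have "\<bar>(v \<bullet> y) * G\<^sup>2 - \<rho> * (v \<bullet> s)\<bar> \<le> G * Y * G\<^sup>2 + 3 / 2 * q * G\<^sup>2 * (G * S)"
      by linarith
    then have "\<bar>\<nu>\<bar> \<le> (G * Y * G\<^sup>2 + 3 / 2 * q * G\<^sup>2 * (G * S)) / \<Delta>"
      using \<Delta>_pos by (simp add: \<nu>_def G_def abs_mult divide_right_mono)
    also have "\<dots> \<le> 2 * (G * Y * G\<^sup>2 + 3 / 2 * q * G\<^sup>2 * (G * S)) / (Y\<^sup>2 * G\<^sup>2)"
      using GSY q by (intro div_\<Delta>) auto
    also have "\<dots> = G * (2 / Y + 3 * S / (s \<bullet> y))"
      using GSY sy by (simp add: q_def field_simps power2_eq_square)
    finally have "\<bar>\<nu>\<bar> * S \<le> G * (2 / Y + 3 * S / (s \<bullet> y)) * S"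
      using GSY by (intro mult_right_mono) auto
    also have "\<dots> = G * (2 * (S / Y) + 3 * (S\<^sup>2 / (s \<bullet> y)))"
      by (simp add: power2_eq_square algebra_simps)
    also have "\<dots> \<le> G * (2 * (1 / \<xi>\<^sub>1) + 3 * (1 / \<xi>\<^sub>1))"
      using ratio lo sy pos GSY
      by (intro mult_left_mono add_mono) (auto simp: S_def field_simps)
    finally show ?thesis by (simp add: algebra_simps)
  qed
  have "norm (\<mu> *\<^sub>R v + \<nu> *\<^sub>R s) \<le> \<bar>\<mu>\<bar> * G + \<bar>\<nu>\<bar> * S"
    unfolding G_def S_def by (metis norm_triangle_ineq norm_scaleR)
  also have "\<dots> \<le> (9 / \<xi>\<^sub>1 + 2 * \<xi>\<^sub>2 / \<xi>\<^sub>1\<^sup>2) * G"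
  proof -
    have "4 / \<xi>\<^sub>1 + 5 / \<xi>\<^sub>1 = 9 / \<xi>\<^sub>1" by (simp flip: add_divide_distrib)
    then have "(4 / \<xi>\<^sub>1 + 2 * \<xi>\<^sub>2 / \<xi>\<^sub>1\<^sup>2) * G + 5 / \<xi>\<^sub>1 * G = (9 / \<xi>\<^sub>1 + 2 * \<xi>\<^sub>2 / \<xi>\<^sub>1\<^sup>2) * G"
      by algebra
    then show ?thesis using add_mono[OF \<mu>_bound \<nu>_bound] by linarith
  qed
  finally show ?thesis
    using descent by (simp add: sufficient_descent_def G_def)
qed

section \<open>Weakening and scaling the descent bounds\<close>

lemma sufficient_descent_mono:
  assumes "sufficient_descent c M v d" "c' \<le> c" "M \<le> M'"
  shows "sufficient_descent c' M' v d"
proof -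
  have "c' * (norm v)\<^sup>2 \<le> c * (norm v)\<^sup>2" "M * norm v \<le> M' * norm v"
    using assms by (auto intro: mult_right_mono)
  then show ?thesis using assms(1) by (auto simp: sufficient_descent_def)
qed

text \<open>Shrinking cannot lengthen \<open>d\<close>, so only the descent constant suffers, by a
  factor of at worst \<open>1 / 2\<close>.\<close>

lemma sufficient_descent_scaleR:
  assumes "sufficient_descent c M v d" "0 \<le> c" "1 / 2 \<le> t" "t \<le> 1"
  shows "sufficient_descent (c / 2) M v (t *\<^sub>R d)"
proof -
  have "t * (v \<bullet> d) \<le> t * (- c * (norm v)\<^sup>2)"
    using assms by (intro mult_left_mono) (auto simp: sufficient_descent_def)
  also have "\<dots> \<le> - (c / 2) * (norm v)\<^sup>2"
    using mult_right_mono[of "1 / 2" t "c * (norm v)\<^sup>2"] assms by (simp add: algebra_simps)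
  finally have "v \<bullet> (t *\<^sub>R d) \<le> - (c / 2) * (norm v)\<^sup>2" by simp
  moreover have "norm (t *\<^sub>R d) \<le> norm d"
    using assms mult_left_le_one_le[of "norm d" t] by simp
  ultimately show ?thesis using assms(1) by (simp add: sufficient_descent_def)
qed

lemma sufficient_descent_uminus:
  "c \<le> 1 \<Longrightarrow> 1 \<le> M \<Longrightarrow> sufficient_descent c M v (- v)"
  by (rule sufficient_descent_mono[of 1 1])
     (auto simp: sufficient_descent_def power2_norm_eq_inner)

lemma sufficient_descent_neg:
  assumes "sufficient_descent c M v d" "0 < c" "v \<noteq> 0"
  shows "v \<bullet> d < 0" "d \<noteq> 0"
proof -
  have "0 < c * (norm v)\<^sup>2" using assms by simp
  then show "v \<bullet> d < 0" using assms(1) by (simp add: sufficient_descent_def)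
  then show "d \<noteq> 0" by auto
qed

section \<open>Descent bounds for the directions of the method\<close>

lemma test_W_bounds:
  assumes "test_W g x \<xi>\<^sub>1 \<xi>\<^sub>2 k" "0 < sty g x k"
  shows "\<xi>\<^sub>1 * (norm (svec x (k - 1)))\<^sup>2 \<le> sty g x k"
    and "(norm (yvec g x (k - 1)))\<^sup>2 \<le> \<xi>\<^sub>2 * sty g x k"
proof -
  have "svec x (k - 1) \<noteq> 0" using assms(2) by (auto simp: sty_def)
  then show "\<xi>\<^sub>1 * (norm (svec x (k - 1)))\<^sup>2 \<le> sty g x k"
    and "(norm (yvec g x (k - 1)))\<^sup>2 \<le> \<xi>\<^sub>2 * sty g x k"
    using assms by (auto simp: test_W_def field_simps)
qed

lemma quad_dir_sufficient_descent:
  assumes "test_W g x \<xi>\<^sub>1 \<xi>\<^sub>2 k" "0 < sty g x k" "g (x k) \<noteq> 0" "0 < \<xi>\<^sub>1" "0 < \<xi>\<^sub>2"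
  shows "sufficient_descent (2 / (5 * \<xi>\<^sub>2)) (9 / \<xi>\<^sub>1 + 2 * \<xi>\<^sub>2 / \<xi>\<^sub>1\<^sup>2) (g (x k)) (quad_dir g x k)"
  using regularized_model_minimizer[of "svec x (k - 1)" "yvec g x (k - 1)" "g (x k)" \<xi>\<^sub>1 \<xi>\<^sub>2 0]
    test_W_bounds[OF assms(1,2)] assms(2-)
  by (simp add: quad_dir_def mu_bar_def nu_bar_def Bmat_def rho_def sty_def gty_def gts_def
      det_2 power2_eq_square)

lemma reg_dir1_sufficient_descent:
  assumes "test_W g x \<xi>\<^sub>1 \<xi>\<^sub>2 k" "0 < sty g x k" "g (x k) \<noteq> 0" "0 < \<xi>\<^sub>1" "0 < \<xi>\<^sub>2" "0 < p"
  shows "sufficient_descent (1 / (5 * \<xi>\<^sub>2)) (9 / \<xi>\<^sub>1 + 2 * \<xi>\<^sub>2 / \<xi>\<^sub>1\<^sup>2) (g (x k)) (reg_dir1 f g x p k)"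
proof -
  define m where "m = min (sigma1 f g x p k * zstar1 f g x p k powr (p - 2)) 1"
  \<comment> \<open>A \<open>powr\<close> value is nonnegative for every argument, so this holds for
    whatever number \<open>zstar1\<close> denotes. Hence \<open>1 / (1 + m)\<close> lies between
    \<open>1 / 2\<close> and 1.\<close>
  have "0 \<le> m" "m \<le> 1" using assms(6) by (auto simp: m_def sigma1_def)
  then have "sufficient_descent (2 / (5 * \<xi>\<^sub>2) / 2) (9 / \<xi>\<^sub>1 + 2 * \<xi>\<^sub>2 / \<xi>\<^sub>1\<^sup>2) (g (x k))
      ((1 / (1 + m)) *\<^sub>R quad_dir g x k)"
    using assms by (intro sufficient_descent_scaleR quad_dir_sufficient_descent)
      (auto simp: field_simps)
  then show ?thesis by (simp add: reg_dir1_def m_def quad_dir_def)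
qed

lemma reg_dir2_sufficient_descent:
  assumes "test_W g x \<xi>\<^sub>1 \<xi>\<^sub>2 k" "0 < sty g x k" "g (x k) \<noteq> 0" "0 < \<xi>\<^sub>1" "0 < \<xi>\<^sub>2" "0 < p"
  shows "sufficient_descent (2 / (5 * \<xi>\<^sub>2)) (9 / \<xi>\<^sub>1 + 2 * \<xi>\<^sub>2 / \<xi>\<^sub>1\<^sup>2) (g (x k)) (reg_dir2 f g x p k)"
proof -
  \<comment> \<open>The cap in the minimum is the quotient that \<open>test_W\<close> bounds by
    \<open>\<xi>\<^sub>2\<close>; the other branch is 0.\<close>
  have "0 \<le> lambda2 f g x p k" "lambda2 f g x p k \<le> \<xi>\<^sub>2"
    using assms by (auto simp: lambda2_def sigma2_def test_W_def min_le_iff_disj)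
  then show ?thesis
    using regularized_model_minimizer[of "svec x (k - 1)" "yvec g x (k - 1)" "g (x k)" \<xi>\<^sub>1 \<xi>\<^sub>2
        "lambda2 f g x p k"] test_W_bounds[OF assms(1,2)] assms(2-)
    by (simp add: reg_dir2_def mu_hat_def nu_hat_def Delta_bar_def rho_def
        sty_def gty_def gts_def)
qed

text \<open>Hypothesis \<open>S\<close> lets the second term undo at most the fraction
  \<open>\<xi>\<^sub>3\<close> of the steepest descent; the Lipschitz bound on \<open>y\<close> and
  the lower curvature bound control its length. The step \<open>s\<close> stands in for the previous
  direction, since the term is invariant under positive scaling.\<close>

lemma Hestenes_Stiefel_sufficient_descent:
  fixes v s y :: "'a::real_inner"
  assumes sy: "0 < s \<bullet> y" and v: "v \<noteq> 0" and "0 < \<xi>\<^sub>1"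
    and lo: "\<xi>\<^sub>1 * (norm s)\<^sup>2 \<le> s \<bullet> y" and Lip: "norm y \<le> L * norm s"
    and S: "\<bar>(v \<bullet> y) * (v \<bullet> s)\<bar> / ((s \<bullet> y) * (norm v)\<^sup>2) \<le> \<xi>\<^sub>3"
  shows "sufficient_descent (1 - \<xi>\<^sub>3) (1 + L / \<xi>\<^sub>1) v (- v + ((v \<bullet> y) / (s \<bullet> y)) *\<^sub>R s)"
proof -
  have "s \<noteq> 0" using sy by auto
  then have "0 < norm s" by simp
  have "0 \<le> L * norm s" using Lip norm_ge_zero order_trans by blast
  then have L: "0 \<le> L" using \<open>0 < norm s\<close> by (simp add: zero_le_mult_iff)
  have "\<bar>(v \<bullet> y) * (v \<bullet> s)\<bar> \<le> \<xi>\<^sub>3 * (norm v)\<^sup>2 * (s \<bullet> y)"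
    using S sy v by (simp add: field_simps)
  then have "(v \<bullet> y) / (s \<bullet> y) * (v \<bullet> s) \<le> \<xi>\<^sub>3 * (norm v)\<^sup>2"
    using sy by (simp add: field_simps)
  then have "v \<bullet> (- v + ((v \<bullet> y) / (s \<bullet> y)) *\<^sub>R s) \<le> - (1 - \<xi>\<^sub>3) * (norm v)\<^sup>2"
    by (simp add: inner_add_right power2_norm_eq_inner algebra_simps)
  moreover have "\<bar>v \<bullet> y\<bar> / (s \<bullet> y) * norm s \<le> L / \<xi>\<^sub>1 * norm v"
  proof -
    have "\<bar>v \<bullet> y\<bar> * norm s \<le> (norm v * (L * norm s)) * norm s"
      using Cauchy_Schwarz_ineq2[of v y] mult_left_mono[OF Lip, of "norm v"]
      by (intro mult_right_mono) auto
    then have "\<bar>v \<bullet> y\<bar> * norm s * \<xi>\<^sub>1 \<le> (norm v * (L * norm s)) * norm s * \<xi>\<^sub>1"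
      by (rule mult_right_mono) (use assms(3) in simp)
    also have "\<dots> = norm v * L * (\<xi>\<^sub>1 * (norm s)\<^sup>2)"
      by (simp add: power2_eq_square)
    also have "\<dots> \<le> norm v * L * (s \<bullet> y)"
      using lo L by (intro mult_left_mono) auto
    finally show ?thesis
      using sy assms(3) by (simp add: field_simps)
  qed
  then have "norm (- v + ((v \<bullet> y) / (s \<bullet> y)) *\<^sub>R s) \<le> (1 + L / \<xi>\<^sub>1) * norm v"
    using norm_triangle_ineq[of "- v" "((v \<bullet> y) / (s \<bullet> y)) *\<^sub>R s"] sy
    by (simp add: algebra_simps)
  ultimately show ?thesis by (simp add: sufficient_descent_def)
qed

section \<open>The nonmonotone reference values\<close>

lemma eta_bounds:
  "0 \<le> eta TYPE('n::finite) k C fnew" "eta TYPE('n) k C fnew \<le> 1"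
  "max 20 CARD('n) dvd k \<Longrightarrow> eta TYPE('n) k C fnew \<le> 999 / 1000"
  by (auto simp: eta_def)

lemma nmQ_ge_1: "1 \<le> nmQ f (x :: nat \<Rightarrow> real^'n) k"
proof (induction k)
  case (Suc k)
  show ?case
  proof (cases k)
    case (Suc j)
    then show ?thesis
      using Suc.IH eta_bounds(1)[where 'n = 'n] by (simp add: Let_def)
  qed simp
qed simp

text \<open>\<open>Q\<close> grows by at most 1 per step and is multiplied by at most 0.999 once in every \<open>l\<close> steps.\<close>

lemma nmQ_le:
  fixes x :: "nat \<Rightarrow> real^'n"
  defines "l \<equiv> max 20 CARD('n)"
  shows "nmQ f x (Suc j) \<le> 1000 * real l + real (j mod l)"
proof (induction j)
  case 0
  show ?case by (simp add: l_def)
next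
  case (Suc j)
  have l: "20 \<le> l" by (simp add: l_def)
  define \<eta> where "\<eta> = eta TYPE('n) (Suc j) (nmC f x (Suc j)) (f (x (Suc (Suc j))))"
  have Q: "nmQ f x (Suc (Suc j)) = \<eta> * nmQ f x (Suc j) + 1"
    by (simp add: \<eta>_def Let_def)
  have Q1: "1 \<le> nmQ f x (Suc j)" by (rule nmQ_ge_1)
  show ?case
  proof (cases "l dvd Suc j")
    \<comment> \<open>Here \<open>j mod l = l - 1\<close> and the remainder drops to 0. The level
      \<open>1000 * l\<close> absorbs this because
      \<open>0.999 * (1000 * l + l - 1) + 1 \<le> 1000 * l\<close>. The remainder is taken of
      \<open>j\<close>, not \<open>Suc j\<close>, as the factor with index \<open>Suc j\<close> acts
      on the next value.\<close>
    case True
    then have "\<eta> * nmQ f x (Suc j) \<le> 999 / 1000 * nmQ f x (Suc j)"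
      using Q1 eta_bounds(3)[where 'n = 'n, of "Suc j"]
      by (intro mult_right_mono) (simp_all add: \<eta>_def l_def)
    moreover have "real (j mod l) \<le> real l - 1"
      using l mod_less_divisor[of l j] by linarith
    moreover have "20 \<le> real l" using l by simp
    ultimately show ?thesis
      using Suc.IH unfolding Q by (simp add: field_simps)
  next
    case False
    then have "Suc j mod l = Suc (j mod l)"
      by (auto simp: mod_Suc dvd_eq_mod_eq_0)
    moreover have "\<eta> * nmQ f x (Suc j) \<le> 1 * nmQ f x (Suc j)"
      using Q1 by (intro mult_right_mono) (auto simp: \<eta>_def intro: eta_bounds(2))
    ultimately show ?thesis
      using Suc.IH unfolding Q by simp
  qed
qed

text \<open>Replace \<open>\<eta> * Q\<close> by the new \<open>Q\<close> minus 1 in the numerator.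
  The recursion starts at index 2 because the value at 1 has its own rule.\<close>

lemma nmC_Suc_Suc:
  fixes x :: "nat \<Rightarrow> real^'n"
  shows "nmC f x (Suc (Suc j)) =
    nmC f x (Suc j) - (nmC f x (Suc j) - f (x (Suc (Suc j)))) / nmQ f x (Suc (Suc j))"
proof -
  have "0 < nmQ f x (Suc (Suc j))"
    using nmQ_ge_1[of f x "Suc (Suc j)"] by linarith
  then show ?thesis
    by (simp add: Let_def field_simps)
qed

text \<open>From index 1 on, the new value moves from the old one towards the new function value by
  the fraction \<open>1 / Q\<close>, at most 1; at index 0 the minimum in the definition gives the
  same.\<close>

lemma nmC_between:
  fixes x :: "nat \<Rightarrow> real^'n"
  assumes "f (x (Suc k)) \<le> nmC f x k"
  shows "f (x (Suc k)) \<le> nmC f x (Suc k)" "nmC f x (Suc k) \<le> nmC f x k"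
proof -
  have "f (x (Suc k)) \<le> nmC f x (Suc k) \<and> nmC f x (Suc k) \<le> nmC f x k"
  proof (cases k)
    case (Suc j)
    define D where "D = nmC f x k - f (x (Suc k))"
    have "0 \<le> D" using assms by (simp add: D_def)
    then have "0 \<le> D / nmQ f x (Suc k)" "D / nmQ f x (Suc k) \<le> D"
      using nmQ_ge_1[of f x "Suc k"] mult_left_mono[of 1 "nmQ f x (Suc k)" D]
      by (auto simp: field_simps)
    moreover have "nmC f x (Suc k) = nmC f x k - D / nmQ f x (Suc k)"
      using Suc nmC_Suc_Suc[of f x j] by (simp only: D_def)
    ultimately show ?thesis by (simp add: D_def)
  qed (use assms in auto)
  then show "f (x (Suc k)) \<le> nmC f x (Suc k)" "nmC f x (Suc k) \<le> nmC f x k" by auto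
qed

section \<open>Convergence from uniform descent\<close>

lemma nonmonotone_Wolfe_gradient_tendsto_0:
  fixes f :: "real^'n \<Rightarrow> real" and g :: "real^'n \<Rightarrow> real^'n"
  assumes c: "0 < c" and \<delta>: "0 < \<delta>" and \<sigma>: "\<sigma> < 1" and L: "0 < L"
    and lip: "L-lipschitz_on \<Theta> g" and bdd: "bdd_below (f ` \<Theta>)"
    and in\<Theta>: "\<And>k. x k \<in> \<Theta>" and nz: "\<And>k. g (x k) \<noteq> 0"
    and \<alpha>: "\<And>k. 0 < \<alpha> k" and step: "\<And>k. x (Suc k) = x k + \<alpha> k *\<^sub>R d k"
    and armijo: "\<And>k. f (x (Suc k)) \<le> nmC f x k + \<delta> * \<alpha> k * (g (x k) \<bullet> d k)"
    and curv: "\<And>k. \<sigma> * (g (x k) \<bullet> d k) \<le> g (x (Suc k)) \<bullet> d k"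
    and sd: "\<And>k. sufficient_descent c M (g (x k)) (d k)"
  shows "(\<lambda>k. norm (g (x k))) \<longlonglongrightarrow> 0"
proof -
  note nmC.simps [simp del] nmQ.simps [simp del]
  \<comment> \<open>Writing \<open>e\<close> for \<open>- (g (x k) \<bullet> d k)\<close>, curvature
    and Lipschitz bound give \<open>(1 - \<sigma>) * e \<le> L * \<alpha> k * (norm (d
    k))\<^sup>2\<close>, while \<open>e / norm (d k)\<close> is at least \<open>c / M\<close> times
    the gradient norm.\<close>
  define K where "K = (1 - \<sigma>) / L * (c / M)\<^sup>2"
  \<comment> \<open>A bound on all \<open>Q\<close> from index 1 on, the remainder in
    \<open>nmQ_le\<close> being at most \<open>l\<close>.\<close>
  define N where "N = 1001 * real (max 20 CARD('n))"
  have neg: "g (x k) \<bullet> d k < 0" and dnz: "d k \<noteq> 0" for k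
    using sufficient_descent_neg[OF sd c nz] by auto
  have "0 < norm (d 0)" using dnz by simp
  also have "\<dots> \<le> M * norm (g (x 0))" using sd[of 0] by (simp add: sufficient_descent_def)
  finally have M: "0 < M" by (simp add: zero_less_mult_iff)
  have K: "0 < K" using c M \<sigma> L by (simp add: K_def)

  have decr: "K * (norm (g (x k)))\<^sup>2 \<le> \<alpha> k * - (g (x k) \<bullet> d k)" for k
  proof -
    define e where "e = - (g (x k) \<bullet> d k)"
    have e: "c * (norm (g (x k)))\<^sup>2 \<le> e" "0 < e"
      using sd[of k] neg[of k] by (auto simp: e_def sufficient_descent_def)
    have dM: "norm (d k) \<le> M * norm (g (x k))"
      using sd[of k] by (simp add: sufficient_descent_def)
    have "(1 - \<sigma>) * e \<le> (g (x (Suc k)) - g (x k)) \<bullet> d k"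
      using curv[of k] by (simp add: e_def inner_diff_left algebra_simps)
    also have "\<dots> \<le> norm (g (x (Suc k)) - g (x k)) * norm (d k)"
      by (rule norm_cauchy_schwarz)
    also have "\<dots> \<le> (L * (\<alpha> k * norm (d k))) * norm (d k)"
      using lipschitz_onD[OF lip in\<Theta> in\<Theta>, of "Suc k" k] \<alpha>[of k]
      by (intro mult_right_mono) (auto simp: dist_norm step)
    also have "\<dots> \<le> L * \<alpha> k * (M * norm (g (x k)))\<^sup>2"
      using L \<alpha>[of k] power_mono[OF dM, of 2] by (simp add: power2_eq_square)
    \<comment> \<open>Multiplying by \<open>e\<close> creates the wanted
      \<open>\<alpha> k * e\<close> on the right; on the left \<open>e * e\<close> supplies a fourth
      power of the gradient norm, of which a square cancels.\<close>
    finally have "(1 - \<sigma>) * e * e \<le> L * \<alpha> k * (M * norm (g (x k)))\<^sup>2 * e"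
      using e by (intro mult_right_mono) auto
    moreover have "(1 - \<sigma>) * (c * (norm (g (x k)))\<^sup>2 * (c * (norm (g (x k)))\<^sup>2)) \<le> (1 - \<sigma>) * (e * e)"
      using e c \<sigma> by (intro mult_left_mono mult_mono) auto
    ultimately have "(1 - \<sigma>) * c\<^sup>2 * (norm (g (x k)))\<^sup>2 * (norm (g (x k)))\<^sup>2
        \<le> L * M\<^sup>2 * (\<alpha> k * e) * (norm (g (x k)))\<^sup>2"
      by (simp add: power2_eq_square mult_ac)
    then have "(1 - \<sigma>) * c\<^sup>2 * (norm (g (x k)))\<^sup>2 \<le> L * M\<^sup>2 * (\<alpha> k * e)"
      using nz[of k] by (simp add: mult_le_cancel_right)
    then show ?thesis
      using L M by (simp add: K_def e_def field_simps)
  qed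

  have f_le: "f (x (Suc k)) \<le> nmC f x k" for k
    using armijo[of k] mult_pos_neg[OF mult_pos_pos[OF \<delta> \<alpha>[of k]] neg[of k]] by linarith
  obtain m where m: "\<And>k. m \<le> f (x k)"
    using bdd in\<Theta> by (auto simp: bdd_below_def)
  have "decseq (nmC f x)"
    using nmC_between(2)[of f x, OF f_le] by (simp add: decseq_Suc_iff)
  moreover have "m \<le> nmC f x k" for k
    using m[of "Suc k"] f_le[of k] by linarith
  ultimately obtain Cinf where C: "nmC f x \<longlonglongrightarrow> Cinf"
    using decseq_convergent[of "nmC f x" m] by metis
  \<comment> \<open>Consecutive differences of a convergent sequence vanish. They are taken from
    index 1 on, where \<open>nmC_Suc_Suc\<close> applies.\<close>
  have "(\<lambda>j. N / (\<delta> * K) * (nmC f x (Suc j) - nmC f x (Suc (Suc j))))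
      \<longlonglongrightarrow> N / (\<delta> * K) * (Cinf - Cinf)"
    by (rule tendsto_mult[OF tendsto_const tendsto_diff[OF LIMSEQ_Suc[OF C] LIMSEQ_Suc[OF LIMSEQ_Suc[OF C]]]])
  then have lim: "(\<lambda>j. N / (\<delta> * K) * (nmC f x (Suc j) - nmC f x (Suc (Suc j)))) \<longlonglongrightarrow> 0"
    by simp
  have bound: "(norm (g (x (Suc j))))\<^sup>2 \<le> N / (\<delta> * K) * (nmC f x (Suc j) - nmC f x (Suc (Suc j)))" for j
  proof -
    define D where "D = nmC f x (Suc j) - f (x (Suc (Suc j)))"
    have "\<delta> * (K * (norm (g (x (Suc j))))\<^sup>2) \<le> \<delta> * (\<alpha> (Suc j) * - (g (x (Suc j)) \<bullet> d (Suc j)))"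
      using decr[of "Suc j"] \<delta> by (intro mult_left_mono) auto
    also have "\<dots> \<le> D"
      using armijo[of "Suc j"] by (simp add: D_def algebra_simps)
    finally have D: "\<delta> * K * (norm (g (x (Suc j))))\<^sup>2 \<le> D" by (simp add: mult_ac)
    have "0 \<le> D" using f_le by (simp add: D_def)
    have "real (Suc j mod max 20 CARD('n)) \<le> real (max 20 CARD('n))"
      by (intro of_nat_mono less_imp_le mod_less_divisor) simp
    then have "nmQ f x (Suc (Suc j)) \<le> N"
      using nmQ_le[of f x "Suc j"] by (simp only: N_def)
    then have "D / N \<le> D / nmQ f x (Suc (Suc j))"
      using \<open>0 \<le> D\<close> nmQ_ge_1[of f x "Suc (Suc j)"] by (intro divide_left_mono) auto
    also have "\<dots> = nmC f x (Suc j) - nmC f x (Suc (Suc j))"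
      unfolding nmC_Suc_Suc[of f x j] by (simp add: D_def)
    finally have "D \<le> N * (nmC f x (Suc j) - nmC f x (Suc (Suc j)))"
      by (simp add: N_def field_simps)
    with D have "\<delta> * K * (norm (g (x (Suc j))))\<^sup>2 \<le> N * (nmC f x (Suc j) - nmC f x (Suc (Suc j)))"
      by linarith
    then show ?thesis using \<delta> K by (simp add: field_simps)
  qed
  have "(\<lambda>j. (norm (g (x (Suc j))))\<^sup>2) \<longlonglongrightarrow> 0"
    by (rule tendsto_sandwich[OF _ _ tendsto_const lim]) (use bound in auto)
  then have "(\<lambda>j. sqrt ((norm (g (x (Suc j))))\<^sup>2)) \<longlonglongrightarrow> sqrt 0"
    by (rule tendsto_real_sqrt)
  then show ?thesis
    by (simp add: filterlim_sequentially_Suc[of "\<lambda>k. norm (g (x k))"])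
qed

section \<open>Runs of the method\<close>

text \<open>Eliminates the counters: they only select a branch, and both the restart and the final
  fallback give steepest descent.\<close>

lemma SMCG_PR_direction_cases:
  assumes "SMCG_PR f g x reg \<delta> \<sigma> \<xi>\<^sub>1 \<xi>\<^sub>2 \<xi>\<^sub>3 \<xi>\<^sub>4 \<xi>\<^sub>5 \<tau>\<^sub>1 \<tau>\<^sub>2 \<gamma> MaxRestart MinQuad \<alpha> d"
  shows "d (Suc k) = - g (x (Suc k))
    \<or> test_W g x \<xi>\<^sub>1 \<xi>\<^sub>2 (Suc k) \<and> d (Suc k) = quad_dir g x (Suc k)
    \<or> test_W g x \<xi>\<^sub>1 \<xi>\<^sub>2 (Suc k) \<and> d (Suc k) = reg (Suc k)
    \<or> test_S g x \<xi>\<^sub>1 \<xi>\<^sub>3 (Suc k) \<and>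
        d (Suc k) = - g (x (Suc k)) + (gty g x (Suc k) / (d k \<bullet> yvec g x k)) *\<^sub>R d k"
  using assms[unfolded SMCG_PR_def, THEN conjunct2, THEN conjunct2]
  by (elim exE conjE, drule_tac x = "Suc k" in spec) (simp add: Let_def split: if_splits)

text \<open>Common to both variants, which differ only in \<open>reg\<close>; its descent bound is
  required just for the steps at which \<open>reg\<close> can be chosen.\<close>

lemma SMCG_PR_gradient_tendsto_0:
  fixes f :: "real^'n \<Rightarrow> real" and g :: "real^'n \<Rightarrow> real^'n"
  assumes run: "SMCG_PR f g x reg \<delta> \<sigma> \<xi>\<^sub>1 \<xi>\<^sub>2 \<xi>\<^sub>3 \<xi>\<^sub>4 \<xi>\<^sub>5 \<tau>\<^sub>1 \<tau>\<^sub>2 \<gamma> MaxRestart MinQuad \<alpha> d"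
    and \<delta>: "0 < \<delta>" and \<sigma>: "\<sigma> < 1" and \<xi>: "0 < \<xi>\<^sub>1" "0 < \<xi>\<^sub>2" "\<xi>\<^sub>3 < 1"
    and level: "{z. f z \<le> f (x 0)} \<subseteq> \<Theta>" and bdd: "bdd_below (f ` \<Theta>)"
    and L: "0 < L" and lip: "L-lipschitz_on \<Theta> g"
    and nz: "\<And>k. g (x k) \<noteq> 0"
    and reg: "\<And>k. test_W g x \<xi>\<^sub>1 \<xi>\<^sub>2 k \<Longrightarrow> 0 < sty g x k \<Longrightarrow>
      sufficient_descent c\<^sub>r M\<^sub>r (g (x k)) (reg k)" and c\<^sub>r: "0 < c\<^sub>r"
  shows "(\<lambda>k. norm (g (x k))) \<longlonglongrightarrow> 0"
proof -
  \<comment> \<open>Worst constants over steepest descent, regularized, quadratic and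
    Hestenes-Stiefel directions.\<close>
  define c where "c = Min {1, c\<^sub>r, 2 / (5 * \<xi>\<^sub>2), 1 - \<xi>\<^sub>3}"
  define M where "M = Max {1, M\<^sub>r, 9 / \<xi>\<^sub>1 + 2 * \<xi>\<^sub>2 / \<xi>\<^sub>1\<^sup>2, 1 + L / \<xi>\<^sub>1}"
  have c: "0 < c" "c \<le> 1" "c \<le> c\<^sub>r" "c \<le> 2 / (5 * \<xi>\<^sub>2)" "c \<le> 1 - \<xi>\<^sub>3"
    using c\<^sub>r \<xi> by (auto simp: c_def)
  have M: "1 \<le> M" "M\<^sub>r \<le> M" "9 / \<xi>\<^sub>1 + 2 * \<xi>\<^sub>2 / \<xi>\<^sub>1\<^sup>2 \<le> M" "1 + L / \<xi>\<^sub>1 \<le> M"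
    by (auto simp: M_def)
  have \<alpha>: "0 < \<alpha> k" and step: "x (Suc k) = x k + \<alpha> k *\<^sub>R d k" for k
    using run by (auto simp: SMCG_PR_def)
  have armijo: "f (x (Suc k)) \<le> nmC f x k + \<delta> * \<alpha> k * (g (x k) \<bullet> d k)"
    and curv: "\<sigma> * (g (x k) \<bullet> d k) \<le> g (x (Suc k)) \<bullet> d k" for k
    using run by (auto simp: SMCG_PR_def)
  \<comment> \<open>The three claims need each other: descent along \<open>d k\<close> and the bound
    on \<open>nmC\<close> keep the next iterate in \<Theta>, and the Lipschitz bound between the two
    iterates then controls a Hestenes-Stiefel direction.\<close>
  have inv: "x k \<in> \<Theta> \<and> nmC f x k \<le> f (x 0) \<and> sufficient_descent c M (g (x k)) (d k)" for k
  proof (induction k)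
    case 0
    have "d 0 = - g (x 0)" using run by (simp add: SMCG_PR_def)
    then show ?case using level c M by (auto intro: sufficient_descent_uminus)
  next
    case (Suc k)
    have neg: "g (x k) \<bullet> d k < 0"
      using sufficient_descent_neg(1)[OF _ c(1) nz] Suc.IH by blast
    then have f_le: "f (x (Suc k)) \<le> nmC f x k"
      using armijo[of k] mult_pos_neg[OF mult_pos_pos[OF \<delta> \<alpha>[of k]] neg] by linarith
    have xk: "x (Suc k) \<in> \<Theta>" using level f_le Suc.IH by auto
    have s: "svec x k = \<alpha> k *\<^sub>R d k" by (simp add: svec_def step)
    have "0 < (1 - \<sigma>) * - (g (x k) \<bullet> d k)" using neg \<sigma> by (intro mult_pos_pos) auto
    also have "\<dots> \<le> d k \<bullet> yvec g x k"
      using curv[of k] by (simp add: yvec_def inner_diff_right inner_commute algebra_simps)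
    finally have dy: "0 < d k \<bullet> yvec g x k" .
    then have sy: "0 < sty g x (Suc k)"
      using \<alpha>[of k] by (simp add: sty_def s)
    consider "d (Suc k) = - g (x (Suc k))"
      | "test_W g x \<xi>\<^sub>1 \<xi>\<^sub>2 (Suc k)" "d (Suc k) = quad_dir g x (Suc k)"
      | "test_W g x \<xi>\<^sub>1 \<xi>\<^sub>2 (Suc k)" "d (Suc k) = reg (Suc k)"
      | "test_S g x \<xi>\<^sub>1 \<xi>\<^sub>3 (Suc k)"
        "d (Suc k) = - g (x (Suc k)) + (gty g x (Suc k) / (d k \<bullet> yvec g x k)) *\<^sub>R d k"
      using SMCG_PR_direction_cases[OF run, of k] by blast
    then have "sufficient_descent c M (g (x (Suc k))) (d (Suc k))"
    proof cases
      case 1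
      then show ?thesis using c M by (auto intro: sufficient_descent_uminus)
    next
      case 2
      show ?thesis unfolding 2(2)
        by (rule sufficient_descent_mono[OF quad_dir_sufficient_descent[OF 2(1) sy nz \<xi>(1,2)] c(4) M(3)])
    next
      case 3
      show ?thesis unfolding 3(2)
        by (rule sufficient_descent_mono[OF reg[OF 3(1) sy] c(3) M(2)])
    next
      case 4
      have sy': "0 < svec x k \<bullet> yvec g x k" using sy by (simp add: sty_def)
      then have "0 < norm (svec x k)" by auto
      then have lo: "\<xi>\<^sub>1 * (norm (svec x k))\<^sup>2 \<le> svec x k \<bullet> yvec g x k"
        and S: "\<bar>(g (x (Suc k)) \<bullet> yvec g x k) * (g (x (Suc k)) \<bullet> svec x k)\<bar>
          / ((svec x k \<bullet> yvec g x k) * (norm (g (x (Suc k))))\<^sup>2) \<le> \<xi>\<^sub>3"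
        using 4(1) by (auto simp: test_S_def sty_def gty_def gts_def field_simps)
      have Lip: "norm (yvec g x k) \<le> L * norm (svec x k)"
        using lipschitz_onD[OF lip xk, of "x k"] Suc.IH
        by (simp add: yvec_def svec_def dist_norm)
      \<comment> \<open>The step length cancels, so the previous direction may be replaced by the
        step.\<close>
      have "(gty g x (Suc k) / (d k \<bullet> yvec g x k)) *\<^sub>R d k
          = ((g (x (Suc k)) \<bullet> yvec g x k) / (svec x k \<bullet> yvec g x k)) *\<^sub>R svec x k"
        using \<alpha>[of k] dy by (simp add: s gty_def)
      then show ?thesis
        using sufficient_descent_mono[OF Hestenes_Stiefel_sufficient_descent[OF sy' nz \<xi>(1) lo Lip S]
            c(5) M(4)] 4(2) by simp
    qed
    then show ?case
      using xk Suc.IH nmC_between(2)[OF f_le] by auto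
  qed
  show ?thesis
    using inv by (intro nonmonotone_Wolfe_gradient_tendsto_0[OF c(1) \<delta> \<sigma> L lip bdd _ nz \<alpha> step armijo curv]) auto
qed

theorem theorem5p3:
  fixes f :: "real^'n \<Rightarrow> real"
    and g :: "real^'n \<Rightarrow> real^'n"
    and \<Theta> :: "(real^'n) set"
    and p \<delta> \<sigma> \<xi>\<^sub>1 \<xi>\<^sub>2 \<xi>\<^sub>3 \<xi>\<^sub>4 \<xi>\<^sub>5 \<tau>\<^sub>1 \<tau>\<^sub>2 \<gamma> L :: real
    and MaxRestart MinQuad :: nat
    and x d :: "nat \<Rightarrow> real^'n"
    and \<alpha> :: "nat \<Rightarrow> real"
  assumes "p > 2"
    and "0 < \<delta>" and "\<delta> < \<sigma>" and "\<sigma> < 1"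
    and "\<xi>\<^sub>1 > 0" and "\<xi>\<^sub>2 > 0" and "0 < \<xi>\<^sub>3" and "\<xi>\<^sub>3 < 1" and "\<xi>\<^sub>4 > 0" and "\<xi>\<^sub>5 > 0"
    and "\<tau>\<^sub>1 > 0" and "\<tau>\<^sub>2 > 0" and "0 < \<gamma>" and "\<gamma> < 1"
    and "MaxRestart > 0" and "MinQuad > 0"
    and gradient: "\<And>z. GDERIV f z :> g z"
    and "continuous_on UNIV g"
    and "open \<Theta>" and "{z. f z \<le> f (x 0)} \<subseteq> \<Theta>"
    and "bdd_below (f ` \<Theta>)"
    and "L > 0" and "L-lipschitz_on \<Theta> g"
    and run:
      "SMCG_PR1 f g x p \<delta> \<sigma> \<xi>\<^sub>1 \<xi>\<^sub>2 \<xi>\<^sub>3 \<xi>\<^sub>4 \<xi>\<^sub>5 \<tau>\<^sub>1 \<tau>\<^sub>2 \<gamma> MaxRestart MinQuad \<alpha> d \<or>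
       SMCG_PR2 f g x p \<delta> \<sigma> \<xi>\<^sub>1 \<xi>\<^sub>2 \<xi>\<^sub>3 \<xi>\<^sub>4 \<xi>\<^sub>5 \<tau>\<^sub>1 \<tau>\<^sub>2 \<gamma> MaxRestart MinQuad \<alpha> d"
    and "\<And>k. g (x k) \<noteq> 0"
  shows "(\<lambda>k. norm (g (x k))) \<longlonglongrightarrow> 0"
proof -
  have p: "0 < p" using assms(1) by simp
  \<comment> \<open>Hides which variant is run; the descent constant is
    \<open>1 / (5 * \<xi>\<^sub>2)\<close> for the first and twice that for the second.\<close>
  have "\<exists>reg c\<^sub>r M\<^sub>r. 0 < c\<^sub>r \<and>
      SMCG_PR f g x reg \<delta> \<sigma> \<xi>\<^sub>1 \<xi>\<^sub>2 \<xi>\<^sub>3 \<xi>\<^sub>4 \<xi>\<^sub>5 \<tau>\<^sub>1 \<tau>\<^sub>2 \<gamma> MaxRestart MinQuad \<alpha> d \<and>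
      (\<forall>k. test_W g x \<xi>\<^sub>1 \<xi>\<^sub>2 k \<longrightarrow> 0 < sty g x k \<longrightarrow>
        sufficient_descent c\<^sub>r M\<^sub>r (g (x k)) (reg k))"
    using run
  proof
    assume "SMCG_PR1 f g x p \<delta> \<sigma> \<xi>\<^sub>1 \<xi>\<^sub>2 \<xi>\<^sub>3 \<xi>\<^sub>4 \<xi>\<^sub>5 \<tau>\<^sub>1 \<tau>\<^sub>2 \<gamma> MaxRestart MinQuad \<alpha> d"
    then have "SMCG_PR f g x (reg_dir1 f g x p) \<delta> \<sigma> \<xi>\<^sub>1 \<xi>\<^sub>2 \<xi>\<^sub>3 \<xi>\<^sub>4 \<xi>\<^sub>5 \<tau>\<^sub>1 \<tau>\<^sub>2 \<gamma>
        MaxRestart MinQuad \<alpha> d"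
      by (simp add: SMCG_PR1_def)
    moreover have "0 < 1 / (5 * \<xi>\<^sub>2)" using assms(6) by simp
    ultimately show ?thesis
      using reg_dir1_sufficient_descent[where g = g and x = x, OF _ _ assms(25,5,6) p] by blast
  next
    assume "SMCG_PR2 f g x p \<delta> \<sigma> \<xi>\<^sub>1 \<xi>\<^sub>2 \<xi>\<^sub>3 \<xi>\<^sub>4 \<xi>\<^sub>5 \<tau>\<^sub>1 \<tau>\<^sub>2 \<gamma> MaxRestart MinQuad \<alpha> d"
    then have "SMCG_PR f g x (reg_dir2 f g x p) \<delta> \<sigma> \<xi>\<^sub>1 \<xi>\<^sub>2 \<xi>\<^sub>3 \<xi>\<^sub>4 \<xi>\<^sub>5 \<tau>\<^sub>1 \<tau>\<^sub>2 \<gamma>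
        MaxRestart MinQuad \<alpha> d"
      by (simp add: SMCG_PR2_def)
    moreover have "0 < 2 / (5 * \<xi>\<^sub>2)" using assms(6) by simp
    ultimately show ?thesis
      using reg_dir2_sufficient_descent[where g = g and x = x, OF _ _ assms(25,5,6) p] by blast
  qed
  then obtain reg c\<^sub>r M\<^sub>r where "0 < c\<^sub>r"
      "SMCG_PR f g x reg \<delta> \<sigma> \<xi>\<^sub>1 \<xi>\<^sub>2 \<xi>\<^sub>3 \<xi>\<^sub>4 \<xi>\<^sub>5 \<tau>\<^sub>1 \<tau>\<^sub>2 \<gamma> MaxRestart MinQuad \<alpha> d"
      "\<And>k. test_W g x \<xi>\<^sub>1 \<xi>\<^sub>2 k \<Longrightarrow> 0 < sty g x k \<Longrightarrow>
        sufficient_descent c\<^sub>r M\<^sub>r (g (x k)) (reg k)"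
    by blast
  then show ?thesis
    using SMCG_PR_gradient_tendsto_0[where g = g and x = x, OF _ assms(2,4,5,6,8,20-23,25)] by blast
qed

end
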